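(* Let $A=\bigoplus_{g\in G}A_g$ be a $G$-graded quasialgebra which is a quasicrossed product of $G$ over $A_e$. If $A$ is simple, then $A_e$ is a semisimple associative algebra.
   Context: $\mathbb{K}$ is an algebraically closed field of characteristic zero and $G$ is a group with neutral element $e$. Algebras are nonzero $\mathbb{K}$-algebras with identity $1$, not necessarily associative unless stated. A $G$-graded algebra is an algebra $A=\bigoplus_{g\in G}A_g$ with $A_gA_h\subset A_{gh}$ for all $g,h\in G$; the set of $g$ with $A_g\neq 0$ generates $G$. A cocycle is a map $\phi:G\times G\times G\to\mathbb{K}^\times$ with $\phi(h,k,l)\phi(g,hk,l)\phi(g,h,k)=\phi(g,h,kl)\phi(gh,k,l)$ and $\phi(g,e,h)=1$ for all $g,h,k,l\in G$. A $G$-graded quasialgebra with cocycle $\phi$ is a $G$-graded algebra satisfying $(x_gx_h)x_k=\phi(g,h,k)\,x_g(x_hx_k)$ for all $x_g\in A_g$, $x_h\in A_h$, $x_k\in A_k$. Then $1\in A_e$ and $A_e$ is an associative algebra. A unit of $A$ is an element having both a left inverse and a right inverse in $A$. $A$ is a quasicrossed product of $G$ over $A_e$ if every $A_g$, $g\in G$, contains a unit of $A$. A graded ideal is a subspace $I=\bigoplus_{g\in G}(I\cap A_g)$ with $IA+AI\subset I$. The graded quasialgebra $A$ is simple if $A^2\neq\{0\}$ and $A$ has no graded ideals other than $\{0\}$ and $A$. An associative algebra is called semisimple here if its Jacobson radical is zero. *)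

theory Defs
  imports "HOL-Algebra.Generated_Groups" "HOL-Computational_Algebra.Polynomial"
begin

text \<open>
  The grading group is a multiplicative group of HOL-Algebra, since it need not be commutative.
  An algebra occupies a whole type, with scalar multiplication \<open>scale\<close> and an explicit product,
  because the multiplicative type classes would force associativity.
\<close>

locale nonassoc_algebra = vector_space scale
  for scale :: "'k::field \<Rightarrow> 'a::ab_group_add \<Rightarrow> 'a" (infixr \<open>*s\<close> 75) +
  fixes mul :: "'a \<Rightarrow> 'a \<Rightarrow> 'a" (infixl \<open>\<bullet>\<close> 70)
    and unity :: 'a
  assumes mul_add_left: "(x + y) \<bullet> z = x \<bullet> z + y \<bullet> z"
    and mul_add_right: "x \<bullet> (y + z) = x \<bullet> y + x \<bullet> z"
    and mul_scale_left: "(a *s x) \<bullet> y = a *s (x \<bullet> y)"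
    and mul_scale_right: "x \<bullet> (a *s y) = a *s (x \<bullet> y)"
    and unity_mul: "unity \<bullet> x = x"
    and mul_unity: "x \<bullet> unity = x"
    and unity_neq_zero: "unity \<noteq> 0"
begin

definition is_unit_elem :: "'a \<Rightarrow> bool" where
  "is_unit_elem u \<longleftrightarrow> (\<exists>v. v \<bullet> u = unity) \<and> (\<exists>w. u \<bullet> w = unity)"

text \<open>
  \<open>V = \<Oplus>\<^sub>i\<^sub>\<in>\<^sub>J W i\<close>, internally: the \<open>W i\<close> are subspaces of the subspace \<open>V\<close>, and each
  \<open>x \<in> V\<close> is in exactly one way a finite sum of components \<open>c i \<in> W i\<close>. Families are
  extended by \<open>0\<close> outside \<open>J\<close> so that uniqueness is meaningful.
\<close>
definition internal_direct_sum :: "'i set \<Rightarrow> ('i \<Rightarrow> 'a set) \<Rightarrow> 'a set \<Rightarrow> bool" where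
  "internal_direct_sum J W V \<longleftrightarrow>
     subspace V \<and> (\<forall>i\<in>J. subspace (W i) \<and> W i \<subseteq> V) \<and>
     (\<forall>x\<in>V. \<exists>!c. (\<forall>i\<in>J. c i \<in> W i) \<and> (\<forall>i. i \<notin> J \<longrightarrow> c i = 0) \<and>
                 finite {i. c i \<noteq> 0} \<and> x = (\<Sum>i | c i \<noteq> 0. c i))"

definition associative_subalgebra :: "'a set \<Rightarrow> bool" where
  "associative_subalgebra R \<longleftrightarrow>
     subspace R \<and> unity \<in> R \<and> (\<forall>x\<in>R. \<forall>y\<in>R. x \<bullet> y \<in> R) \<and>
     (\<forall>x\<in>R. \<forall>y\<in>R. \<forall>z\<in>R. (x \<bullet> y) \<bullet> z = x \<bullet> (y \<bullet> z))"

definition left_ideal_in :: "'a set \<Rightarrow> 'a set \<Rightarrow> bool" where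
  "left_ideal_in R L \<longleftrightarrow> subspace L \<and> L \<subseteq> R \<and> (\<forall>r\<in>R. \<forall>x\<in>L. r \<bullet> x \<in> L)"

definition maximal_left_ideal_in :: "'a set \<Rightarrow> 'a set \<Rightarrow> bool" where
  "maximal_left_ideal_in R M \<longleftrightarrow> left_ideal_in R M \<and> M \<noteq> R \<and>
     (\<forall>L. left_ideal_in R L \<and> M \<subseteq> L \<longrightarrow> L = M \<or> L = R)"

definition jacobson_radical :: "'a set \<Rightarrow> 'a set" where
  "jacobson_radical R = {x \<in> R. \<forall>M. maximal_left_ideal_in R M \<longrightarrow> x \<in> M}"

definition semisimple_associative_subalgebra :: "'a set \<Rightarrow> bool" where
  "semisimple_associative_subalgebra R \<longleftrightarrow>
     associative_subalgebra R \<and> jacobson_radical R = {0}"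

end

locale graded_algebra = nonassoc_algebra scale mul unity + G: group G
  for scale :: "'k::field \<Rightarrow> 'a::ab_group_add \<Rightarrow> 'a" (infixr \<open>*s\<close> 75)
    and mul :: "'a \<Rightarrow> 'a \<Rightarrow> 'a" (infixl \<open>\<bullet>\<close> 70)
    and unity :: 'a
    and G :: "('g, 'm) monoid_scheme" (structure) +
  fixes A :: "'g \<Rightarrow> 'a set"
  assumes grading: "internal_direct_sum (carrier G) A UNIV"
    and graded_mul: "\<lbrakk>g \<in> carrier G; h \<in> carrier G; x \<in> A g; y \<in> A h\<rbrakk> \<Longrightarrow> x \<bullet> y \<in> A (g \<otimes> h)"
    and support_generates: "generate G {g \<in> carrier G. A g \<noteq> {0}} = carrier G"
begin

definition quasicrossed_product :: bool where
  "quasicrossed_product \<longleftrightarrow> (\<forall>g\<in>carrier G. \<exists>u\<in>A g. is_unit_elem u)"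

definition graded_ideal :: "'a set \<Rightarrow> bool" where
  "graded_ideal I \<longleftrightarrow> internal_direct_sum (carrier G) (\<lambda>g. I \<inter> A g) I \<and>
     (\<forall>x\<in>I. \<forall>a. x \<bullet> a \<in> I \<and> a \<bullet> x \<in> I)"

definition graded_simple :: bool where
  "graded_simple \<longleftrightarrow> span {x \<bullet> y | x y. True} \<noteq> {0} \<and>
     (\<forall>I. graded_ideal I \<longrightarrow> I = {0} \<or> I = UNIV)"

end

definition cocycle :: "('g, 'm) monoid_scheme \<Rightarrow> ('g \<Rightarrow> 'g \<Rightarrow> 'g \<Rightarrow> 'k::field) \<Rightarrow> bool" where
  "cocycle G \<phi> \<longleftrightarrow>
     (\<forall>g\<in>carrier G. \<forall>h\<in>carrier G. \<forall>k\<in>carrier G. \<phi> g h k \<noteq> 0) \<and>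
     (\<forall>g\<in>carrier G. \<forall>h\<in>carrier G. \<forall>k\<in>carrier G. \<forall>l\<in>carrier G.
        \<phi> h k l * \<phi> g (h \<otimes>\<^bsub>G\<^esub> k) l * \<phi> g h k = \<phi> g h (k \<otimes>\<^bsub>G\<^esub> l) * \<phi> (g \<otimes>\<^bsub>G\<^esub> h) k l) \<and>
     (\<forall>g\<in>carrier G. \<forall>h\<in>carrier G. \<phi> g \<one>\<^bsub>G\<^esub> h = 1)"

locale graded_quasialgebra = graded_algebra scale mul unity G A
  for scale :: "'k::field \<Rightarrow> 'a::ab_group_add \<Rightarrow> 'a" (infixr \<open>*s\<close> 75)
    and mul :: "'a \<Rightarrow> 'a \<Rightarrow> 'a" (infixl \<open>\<bullet>\<close> 70)
    and unity :: 'a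
    and G :: "('g, 'm) monoid_scheme" (structure)
    and A :: "'g \<Rightarrow> 'a set" +
  fixes \<phi> :: "'g \<Rightarrow> 'g \<Rightarrow> 'g \<Rightarrow> 'k"
  assumes cocycle: "cocycle G \<phi>"
    and quasiassoc: "\<lbrakk>g \<in> carrier G; h \<in> carrier G; k \<in> carrier G; x \<in> A g; y \<in> A h; z \<in> A k\<rbrakk>
      \<Longrightarrow> (x \<bullet> y) \<bullet> z = \<phi> g h k *s (x \<bullet> (y \<bullet> z))"

end

theory Submission
  imports Defs
begin

text \<open>
  Let \<open>J\<close> be the Jacobson radical of \<open>A\<^sub>e\<close>, described by left quasi-regularity, and let \<open>I\<^sub>g\<close> be the
  set of \<open>x \<in> A\<^sub>g\<close> such that \<open>A\<^sub>h x \<subseteq> J\<close> for \<open>h = g\<inverse>\<close>. Then \<open>\<Oplus> I\<^sub>g\<close> is clearly a graded left ideal.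
  It is a right ideal because \<open>A\<^sub>h y \<subseteq> J\<close> implies \<open>y A\<^sub>h \<subseteq> J\<close> for \<open>y\<close> of degree \<open>h\<inverse>\<close>: up to a value
  of the cocycle, a left inverse of \<open>1 - a y\<close> yields one of \<open>1 - y a\<close> by the usual identity
  \<open>(1 - y a)\<inverse> = 1 + y (1 - a y)\<inverse> a\<close>. Its component of degree \<open>e\<close> is \<open>J \<noteq> A\<^sub>e\<close>, so simplicity
  forces \<open>J = 0\<close>.
\<close>

section \<open>Left ideals and the Jacobson radical of an associative subalgebra\<close>

context nonassoc_algebra
begin

lemma mul_zero_left [simp]: "0 \<bullet> x = 0"
  using mul_add_left[of 0 0 x] by simp

lemma mul_zero_right [simp]: "x \<bullet> 0 = 0"
  using mul_add_right[of x 0 0] by simp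

lemma mul_diff_left: "(x - y) \<bullet> z = x \<bullet> z - y \<bullet> z"
  using mul_add_left[of "x - y" y z] by (simp add: algebra_simps)

lemma mul_diff_right: "x \<bullet> (y - z) = x \<bullet> y - x \<bullet> z"
  using mul_add_right[of x "y - z" z] by (simp add: algebra_simps)

lemma mul_sum_left: "sum f F \<bullet> y = (\<Sum>i\<in>F. f i \<bullet> y)"
  by (induction F rule: infinite_finite_induct) (auto simp: mul_add_left)

lemma mul_sum_right: "x \<bullet> sum f F = (\<Sum>i\<in>F. x \<bullet> f i)"
  by (induction F rule: infinite_finite_induct) (auto simp: mul_add_right)

text \<open>This turns properness of a left ideal into the omission of a single element, a condition
  that survives unions of chains.\<close>

lemma left_ideal_in_eq_iff_unity:
  assumes "associative_subalgebra R" "left_ideal_in R L"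
  shows "L = R \<longleftrightarrow> unity \<in> L"
proof
  assume u: "unity \<in> L"
  have "r \<in> L" if "r \<in> R" for r
  proof -
    have "r \<bullet> unity \<in> L" using assms(2) u that unfolding left_ideal_in_def by blast
    then show ?thesis by (simp add: mul_unity)
  qed
  then show "L = R" using assms(2) unfolding left_ideal_in_def by blast
next
  assume "L = R"
  then show "unity \<in> L" using assms(1) unfolding associative_subalgebra_def by blast
qed

lemma left_ideal_in_Union_chain:
  assumes "C \<noteq> {}" "\<And>X. X \<in> C \<Longrightarrow> left_ideal_in R X"
    and "\<And>X Y. X \<in> C \<Longrightarrow> Y \<in> C \<Longrightarrow> X \<subseteq> Y \<or> Y \<subseteq> X"
  shows "left_ideal_in R (\<Union>C)"
proof -
  have sub: "subspace X" if "X \<in> C" for X using assms(2)[OF that] by (simp add: left_ideal_in_def)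
  have "subspace (\<Union>C)"
  proof (rule subspaceI)
    show "0 \<in> \<Union>C" using assms(1) sub subspace_0 by blast
    show "x + y \<in> \<Union>C" if "x \<in> \<Union>C" "y \<in> \<Union>C" for x y
    proof -
      obtain X Y where XY: "X \<in> C" "Y \<in> C" "x \<in> X" "y \<in> Y" using \<open>x \<in> \<Union>C\<close> \<open>y \<in> \<Union>C\<close> by blast
      then obtain Z where "Z \<in> C" "x \<in> Z" "y \<in> Z" using assms(3) by blast
      then show ?thesis using sub subspace_add by blast
    qed
    show "c *s x \<in> \<Union>C" if "x \<in> \<Union>C" for c x
      using that sub subspace_scale by blast
  qed
  then show ?thesis using assms(2) unfolding left_ideal_in_def by blast
qed

text \<open>Zorn's lemma is applied to the left ideals that contain \<open>L\<close> and omit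
  \<open>unity\<close>.\<close>

lemma exists_maximal_left_ideal_in:
  assumes R: "associative_subalgebra R" and L: "left_ideal_in R L" "unity \<notin> L"
  shows "\<exists>M. maximal_left_ideal_in R M \<and> L \<subseteq> M"
proof -
  let ?S = "{X. left_ideal_in R X \<and> L \<subseteq> X \<and> unity \<notin> X}"
  have "\<exists>M\<in>?S. \<forall>X\<in>?S. M \<subseteq> X \<longrightarrow> X = M"
  proof (rule subset_Zorn_nonempty)
    show "?S \<noteq> {}" using L by blast
    show "\<Union>C \<in> ?S" if "C \<noteq> {}" "subset.chain ?S C" for C
    proof -
      have mem: "left_ideal_in R X \<and> L \<subseteq> X \<and> unity \<notin> X" if "X \<in> C" for X
        using \<open>subset.chain ?S C\<close> that unfolding subset_chain_def by blast
      have "left_ideal_in R (\<Union>C)"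
      proof (rule left_ideal_in_Union_chain[OF \<open>C \<noteq> {}\<close>])
        show "left_ideal_in R X" if "X \<in> C" for X using mem[OF that] by simp
        show "X \<subseteq> Y \<or> Y \<subseteq> X" if "X \<in> C" "Y \<in> C" for X Y
          using \<open>subset.chain ?S C\<close> that unfolding subset_chain_def by simp
      qed
      then show ?thesis using mem \<open>C \<noteq> {}\<close> by blast
    qed
  qed
  then obtain M where MS: "M \<in> ?S" and Mmax: "\<forall>X\<in>?S. M \<subseteq> X \<longrightarrow> X = M" by (rule bexE)
  then have M: "left_ideal_in R M" "L \<subseteq> M" "unity \<notin> M" by simp_all
  have max: "X = M" if "left_ideal_in R X" "unity \<notin> X" "M \<subseteq> X" for X
  proof -
    have "X \<in> ?S" using that M(2) by simp
    then show ?thesis using Mmax that(3) by blast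
  qed
  \<comment> \<open>A left ideal above \<open>M\<close> either omits \<open>unity\<close>, and then
    equals \<open>M\<close>, or contains it and is \<open>R\<close>.\<close>
  have "maximal_left_ideal_in R M"
    unfolding maximal_left_ideal_in_def
    using M max left_ideal_in_eq_iff_unity[OF R] by blast
  then show ?thesis using M(2) by blast
qed

lemma jacobson_radical_left_ideal_in:
  assumes "associative_subalgebra R"
  shows "left_ideal_in R (jacobson_radical R)"
proof -
  have R: "subspace R" "\<And>x y. x \<in> R \<Longrightarrow> y \<in> R \<Longrightarrow> x \<bullet> y \<in> R"
    using assms unfolding associative_subalgebra_def by auto
  have M: "subspace M" "\<And>x y. x \<in> R \<Longrightarrow> y \<in> M \<Longrightarrow> x \<bullet> y \<in> M" if "maximal_left_ideal_in R M" for M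
    using that unfolding maximal_left_ideal_in_def left_ideal_in_def by auto
  have "subspace (jacobson_radical R)"
    unfolding jacobson_radical_def
    by (rule subspaceI) (auto simp: M R subspace_0 subspace_add subspace_scale)
  then show ?thesis
    unfolding left_ideal_in_def by (auto simp: jacobson_radical_def R M)
qed

text \<open>If 1 - r x had no left inverse, a maximal left ideal would contain both 1 - r x and r x,
  hence 1. Conversely, if a maximal left ideal \<open>M\<close> misses \<open>x\<close>, then M + R
  x = R gives 1 = m + r x, so the left invertible element 1 - r x lies in \<open>M\<close>. This
  form is the one that can be carried from one order of a product to the other.\<close>

lemma jacobson_radical_iff_left_quasiregular:
  assumes R: "associative_subalgebra R"
  shows "x \<in> jacobson_radical R \<longleftrightarrow>
    x \<in> R \<and> (\<forall>r\<in>R. \<exists>c\<in>R. c \<bullet> (unity - r \<bullet> x) = unity)"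
proof -
  have sub: "subspace R" and one: "unity \<in> R" and closed: "\<And>x y. x \<in> R \<Longrightarrow> y \<in> R \<Longrightarrow> x \<bullet> y \<in> R"
    and assoc: "\<And>x y z. x \<in> R \<Longrightarrow> y \<in> R \<Longrightarrow> z \<in> R \<Longrightarrow> (x \<bullet> y) \<bullet> z = x \<bullet> (y \<bullet> z)"
    using R unfolding associative_subalgebra_def by auto
  show ?thesis
  proof (intro iffI conjI ballI)
    assume x: "x \<in> jacobson_radical R"
    then show xR: "x \<in> R" unfolding jacobson_radical_def by blast
    fix r assume r: "r \<in> R"
    define t where "t = unity - r \<bullet> x"
    have t: "t \<in> R" unfolding t_def using sub one closed r xR subspace_diff by blast
    \<comment> \<open>The principal left ideal R t: it contains \<open>unity\<close> exactly when
      \<open>t\<close> has a left inverse in \<open>R\<close>.\<close>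
    let ?L = "(\<lambda>c. c \<bullet> t) ` R"
    have "subspace ?L"
    proof (rule subspaceI)
      show "0 \<in> ?L" using subspace_0[OF sub] mul_zero_left by (metis image_eqI)
      show "y + z \<in> ?L" if "y \<in> ?L" "z \<in> ?L" for y z
        using that subspace_add[OF sub] by (auto simp flip: mul_add_left)
      show "a *s y \<in> ?L" if "y \<in> ?L" for a y
        using that subspace_scale[OF sub] by (auto simp flip: mul_scale_left)
    qed
    moreover have "s \<bullet> (c \<bullet> t) \<in> ?L" if "s \<in> R" "c \<in> R" for s c
      using that closed t assoc[of s c t, symmetric] by auto
    ultimately have L: "left_ideal_in R ?L"
      unfolding left_ideal_in_def using closed t by auto
    have "unity \<in> ?L"
    proof (rule ccontr)
      assume "unity \<notin> ?L"
      then obtain M where M: "maximal_left_ideal_in R M" "?L \<subseteq> M"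
        using exists_maximal_left_ideal_in[OF R L] by blast
      then have lM: "left_ideal_in R M" and sM: "subspace M" and "M \<noteq> R"
        unfolding maximal_left_ideal_in_def left_ideal_in_def by auto
      have "t \<in> M" using M(2) one unity_mul[of t] by force
      moreover have "r \<bullet> x \<in> M" using x M(1) lM r unfolding jacobson_radical_def left_ideal_in_def by blast
      ultimately have "t + r \<bullet> x \<in> M" using sM subspace_add by blast
      then have "unity \<in> M" by (simp add: t_def)
      then show False using left_ideal_in_eq_iff_unity[OF R lM] \<open>M \<noteq> R\<close> by blast
    qed
    then show "\<exists>c\<in>R. c \<bullet> (unity - r \<bullet> x) = unity" unfolding t_def by (metis imageE)
  next
    assume x: "x \<in> R \<and> (\<forall>r\<in>R. \<exists>c\<in>R. c \<bullet> (unity - r \<bullet> x) = unity)"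
    have "x \<in> M" if M: "maximal_left_ideal_in R M" for M
    proof (rule ccontr)
      assume "x \<notin> M"
      have lM: "left_ideal_in R M" and sM: "subspace M" and "M \<noteq> R" "M \<subseteq> R"
        using M unfolding maximal_left_ideal_in_def left_ideal_in_def by auto
      have mM: "\<And>r m. r \<in> R \<Longrightarrow> m \<in> M \<Longrightarrow> r \<bullet> m \<in> M" using lM unfolding left_ideal_in_def by auto
      \<comment> \<open>The left ideal generated by \<open>M\<close> and \<open>x\<close>;
        maximality will force it to be \<open>R\<close>.\<close>
      let ?L = "{m + r \<bullet> x | m r. m \<in> M \<and> r \<in> R}"
      have "subspace ?L"
      proof (rule subspaceI)
        have "0 = 0 + 0 \<bullet> x" by simp
        then show "0 \<in> ?L" using subspace_0[OF sub] subspace_0[OF sM] by blast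
        show "y + z \<in> ?L" if yz: "y \<in> ?L" "z \<in> ?L" for y z
        proof -
          obtain m r n s where "m \<in> M" "n \<in> M" "r \<in> R" "s \<in> R" "y = m + r \<bullet> x" "z = n + s \<bullet> x"
            using yz by blast
          moreover from this have "y + z = (m + n) + (r + s) \<bullet> x"
            by (simp add: mul_add_left algebra_simps)
          ultimately show ?thesis using subspace_add[OF sub] subspace_add[OF sM] by blast
        qed
        show "a *s y \<in> ?L" if y: "y \<in> ?L" for a y
        proof -
          obtain m r where "m \<in> M" "r \<in> R" "y = m + r \<bullet> x" using y by blast
          moreover from this have "a *s y = a *s m + (a *s r) \<bullet> x"
            by (simp add: mul_scale_left scale_right_distrib)
          ultimately show ?thesis using subspace_scale[OF sub] subspace_scale[OF sM] by blast
        qed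
      qed
      moreover have "?L \<subseteq> R" using x \<open>M \<subseteq> R\<close> closed subspace_add[OF sub] by blast
      moreover have "s \<bullet> y \<in> ?L" if s: "s \<in> R" and y: "y \<in> ?L" for s y
      proof -
        obtain m r where "m \<in> M" "r \<in> R" "y = m + r \<bullet> x" using y by blast
        moreover from this have "s \<bullet> y = s \<bullet> m + (s \<bullet> r) \<bullet> x"
          using assoc s x by (simp add: mul_add_right)
        ultimately show ?thesis using closed mM s by blast
      qed
      ultimately have L: "left_ideal_in R ?L" unfolding left_ideal_in_def by blast
      have "M \<subseteq> ?L"
      proof
        fix m assume "m \<in> M"
        moreover have "m = m + 0 \<bullet> x" by simp
        ultimately show "m \<in> ?L" using subspace_0[OF sub] by blast
      qed
      moreover have "x \<in> ?L"
      proof -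
        have "x = 0 + unity \<bullet> x" by (simp add: unity_mul)
        then show ?thesis using subspace_0[OF sM] one by blast
      qed
      ultimately have "?L = R" using M L \<open>x \<notin> M\<close> unfolding maximal_left_ideal_in_def by blast
      then obtain m r where m: "m \<in> M" "r \<in> R" "unity = m + r \<bullet> x" using one by blast
      then have "m = unity - r \<bullet> x" by (simp add: algebra_simps)
      moreover obtain c where "c \<in> R" "c \<bullet> (unity - r \<bullet> x) = unity" using x m(2) by blast
      ultimately have "unity \<in> M" using mM m(1) by metis
      then show False using left_ideal_in_eq_iff_unity[OF R lM] \<open>M \<noteq> R\<close> by blast
    qed
    then show "x \<in> jacobson_radical R" using x unfolding jacobson_radical_def by blast
  qed
qed

text \<open>Quasi-regularity of 1 with multiplier 1 would give 1 - 1 = 0 a left inverse.\<close>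

lemma unity_notin_jacobson_radical:
  assumes "associative_subalgebra R"
  shows "unity \<notin> jacobson_radical R"
proof
  assume "unity \<in> jacobson_radical R"
  then obtain c where "c \<bullet> (unity - unity \<bullet> unity) = unity"
    using jacobson_radical_iff_left_quasiregular[OF assms] by blast
  then show False using unity_neq_zero by (simp add: mul_unity)
qed

end

section \<open>Homogeneous components and graded ideals\<close>

context graded_algebra
begin

text \<open>The predicate repeats the one in \<open>internal_direct_sum\<close>, so the grading
  directly supplies existence and uniqueness. The value 0 outside the carrier makes the family
  unique as a total function.\<close>

definition component :: "'a \<Rightarrow> 'g \<Rightarrow> 'a" where
  "component x = (THE c. (\<forall>i\<in>carrier G. c i \<in> A i) \<and> (\<forall>i. i \<notin> carrier G \<longrightarrow> c i = 0) \<and>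
                 finite {i. c i \<noteq> 0} \<and> x = (\<Sum>i | c i \<noteq> 0. c i))"

lemma subspace_A: "g \<in> carrier G \<Longrightarrow> subspace (A g)"
  using grading unfolding internal_direct_sum_def by blast

lemma ex1_decomposition:
  "\<exists>!c. (\<forall>i\<in>carrier G. c i \<in> A i) \<and> (\<forall>i. i \<notin> carrier G \<longrightarrow> c i = 0) \<and>
        finite {i. c i \<noteq> 0} \<and> x = (\<Sum>i | c i \<noteq> 0. c i)"
  using grading unfolding internal_direct_sum_def by blast

lemma component_decomposition:
  "(\<forall>i\<in>carrier G. component x i \<in> A i) \<and> (\<forall>i. i \<notin> carrier G \<longrightarrow> component x i = 0) \<and>
   finite {i. component x i \<noteq> 0} \<and> x = (\<Sum>i | component x i \<noteq> 0. component x i)"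
  unfolding component_def by (rule theI'[OF ex1_decomposition])

lemma
  shows component_mem: "g \<in> carrier G \<Longrightarrow> component x g \<in> A g"
    and component_outside: "g \<notin> carrier G \<Longrightarrow> component x g = 0"
    and finite_component: "finite {i. component x i \<noteq> 0}"
    and sum_component: "(\<Sum>i | component x i \<noteq> 0. component x i) = x"
  using component_decomposition[of x] by auto

lemma component_nonzero_carrier: "component x g \<noteq> 0 \<Longrightarrow> g \<in> carrier G"
  using component_outside by blast

text \<open>The finite set \<open>F\<close> may be larger than the support of \<open>c\<close>, so
  that families with different supports can be summed over a common index set.\<close>

lemma component_eqI:
  assumes "\<And>g. g \<in> carrier G \<Longrightarrow> c g \<in> A g" "\<And>g. g \<notin> carrier G \<Longrightarrow> c g = 0"
    and F: "finite F" "{g. c g \<noteq> 0} \<subseteq> F" and x: "x = sum c F"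
  shows "component x = c"
proof -
  have "x = (\<Sum>i | c i \<noteq> 0. c i)"
    unfolding x using F by (intro sum.mono_neutral_right) auto
  moreover have "finite {i. c i \<noteq> 0}" using F finite_subset by blast
  ultimately show ?thesis
    unfolding component_def using assms(1,2) by (intro the1_equality[OF ex1_decomposition]) auto
qed

lemma component_homogeneous:
  assumes "g \<in> carrier G" "x \<in> A g"
  shows "component x = (\<lambda>h. if h = g then x else 0)"
  by (rule component_eqI[where F = "{g}"]) (use assms subspace_A subspace_0 in auto)

lemma component_add: "component (x + y) = (\<lambda>g. component x g + component y g)"
proof (rule component_eqI)
  let ?F = "{i. component x i \<noteq> 0} \<union> {i. component y i \<noteq> 0}"
  show "finite ?F" using finite_component by blast
  show "{g. component x g + component y g \<noteq> 0} \<subseteq> ?F" by auto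
  have "x = sum (component x) ?F"
    using \<open>finite ?F\<close> by (subst sum_component[of x, symmetric], intro sum.mono_neutral_left) auto
  moreover have "y = sum (component y) ?F"
    using \<open>finite ?F\<close> by (subst sum_component[of y, symmetric], intro sum.mono_neutral_left) auto
  ultimately show "x + y = (\<Sum>g\<in>?F. component x g + component y g)"
    by (simp add: sum.distrib)
qed (auto simp: component_outside intro: subspace_add subspace_A component_mem)

lemma component_scale: "component (a *s x) = (\<lambda>g. a *s component x g)"
proof (rule component_eqI)
  show "finite {i. component x i \<noteq> 0}" by (rule finite_component)
  show "a *s x = (\<Sum>g | component x g \<noteq> 0. a *s component x g)"
    by (simp add: sum_component flip: scale_sum_right)
qed (auto simp: component_outside intro: subspace_scale subspace_A component_mem)

lemma component_zero: "component 0 g = 0"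
  using component_scale[of 0 0] by simp

lemma component_sum: "component (sum f F) g = (\<Sum>i\<in>F. component (f i) g)"
  by (induction F rule: infinite_finite_induct) (auto simp: component_zero component_add)

text \<open>The degree \<open>\<one>\<close> component of \<open>unity\<close> is a right identity
  for all homogeneous elements, as comparing degrees in x = x 1 shows. By linearity it is one for
  \<open>unity\<close> itself, hence equals \<open>unity\<close>.\<close>

lemma unity_homogeneous: "unity \<in> A \<one>"
proof -
  let ?S = "{i. component unity i \<noteq> 0}"
  let ?e = "component unity \<one>"
  have hom: "x \<bullet> ?e = x" if h: "h \<in> carrier G" and x: "x \<in> A h" for h x
  proof -
    have "x = component x h" using component_homogeneous[OF h x] by simp
    also have "\<dots> = component (x \<bullet> (\<Sum>g\<in>?S. component unity g)) h"
      by (simp add: sum_component mul_unity)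
    also have "\<dots> = (\<Sum>g\<in>?S. component (x \<bullet> component unity g) h)"
      by (simp add: mul_sum_right component_sum)
    also have "\<dots> = (\<Sum>g\<in>?S. if g = \<one> then x \<bullet> ?e else 0)"
    proof (rule sum.cong)
      fix g assume "g \<in> ?S"
      then have g: "g \<in> carrier G" by (auto dest: component_nonzero_carrier)
      have m: "x \<bullet> component unity g \<in> A (h \<otimes> g)" using graded_mul h g x component_mem by blast
      \<comment> \<open>By cancellation in the group, only the component of \<open>unity\<close> of
        degree \<open>\<one>\<close> contributes to degree \<open>h\<close>.\<close>
      have "h = h \<otimes> g \<longleftrightarrow> g = \<one>" using g h G.r_cancel_one' by auto
      then show "component (x \<bullet> component unity g) h = (if g = \<one> then x \<bullet> ?e else 0)"
        using component_homogeneous[OF _ m] g h by simp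
    qed simp
    also have "\<dots> = x \<bullet> ?e" using finite_component by (auto simp: sum.delta)
    finally show ?thesis by simp
  qed
  \<comment> \<open>The product of \<open>unity\<close> and \<open>?e\<close> is evaluated in two
    ways: by the left identity law, and termwise by \<open>hom\<close>.\<close>
  have "?e = unity \<bullet> ?e" by (simp add: unity_mul)
  also have "\<dots> = (\<Sum>g\<in>?S. component unity g) \<bullet> ?e" by (simp add: sum_component)
  also have "\<dots> = (\<Sum>g\<in>?S. component unity g)"
    unfolding mul_sum_left
    by (rule sum.cong) (use component_nonzero_carrier hom component_mem in blast)+
  finally show ?thesis using component_mem[of \<one> unity] by (simp add: sum_component)
qed

text \<open>Closure under arbitrary factors reduces to homogeneous ones, because a product is the
  finite double sum of the products of components. The decomposition inside the ideal is the one of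
  the whole algebra.\<close>

lemma graded_ideal_of_components:
  assumes sub: "\<And>g. g \<in> carrier G \<Longrightarrow> subspace (B g) \<and> B g \<subseteq> A g"
    and left: "\<And>g h x a. \<lbrakk>g \<in> carrier G; h \<in> carrier G; x \<in> B g; a \<in> A h\<rbrakk> \<Longrightarrow> a \<bullet> x \<in> B (h \<otimes> g)"
    and right: "\<And>g h x a. \<lbrakk>g \<in> carrier G; h \<in> carrier G; x \<in> B g; a \<in> A h\<rbrakk> \<Longrightarrow> x \<bullet> a \<in> B (g \<otimes> h)"
  shows "graded_ideal {x. \<forall>g\<in>carrier G. component x g \<in> B g}" (is "graded_ideal ?I")
proof -
  have zero: "0 \<in> B g" if "g \<in> carrier G" for g using sub that subspace_0 by blast
  have I: "subspace ?I"
  proof (rule subspaceI)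
    have sB: "subspace (B g)" if "g \<in> carrier G" for g using sub that by blast
    show "0 \<in> ?I" by (simp add: component_zero zero)
    show "x + y \<in> ?I" if "x \<in> ?I" "y \<in> ?I" for x y
      using that by (simp add: component_add subspace_add[OF sB])
    show "c *s x \<in> ?I" if "x \<in> ?I" for c x
      using that by (simp add: component_scale subspace_scale[OF sB])
  qed
  have hom: "x \<in> ?I" if "g \<in> carrier G" "x \<in> B g" for g x
  proof -
    have "x \<in> A g" using that sub by blast
    then show ?thesis using component_homogeneous[OF that(1)] that(2) zero by simp
  qed
  have dec: "\<exists>!c. (\<forall>i\<in>carrier G. c i \<in> ?I \<inter> A i) \<and> (\<forall>i. i \<notin> carrier G \<longrightarrow> c i = 0) \<and>
               finite {i. c i \<noteq> 0} \<and> x = (\<Sum>i | c i \<noteq> 0. c i)" if x: "x \<in> ?I" for x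
  proof (rule ex1I)
    show "(\<forall>i\<in>carrier G. component x i \<in> ?I \<inter> A i) \<and> (\<forall>i. i \<notin> carrier G \<longrightarrow> component x i = 0) \<and>
          finite {i. component x i \<noteq> 0} \<and> x = (\<Sum>i | component x i \<noteq> 0. component x i)"
      using x hom component_decomposition[of x] by blast
    \<comment> \<open>Uniqueness is inherited: a family with values in the intersections is also a
      family for \<open>A\<close>.\<close>
    fix c assume "(\<forall>i\<in>carrier G. c i \<in> ?I \<inter> A i) \<and> (\<forall>i. i \<notin> carrier G \<longrightarrow> c i = 0) \<and>
               finite {i. c i \<noteq> 0} \<and> x = (\<Sum>i | c i \<noteq> 0. c i)"
    then show "c = component x"
      by (intro component_eqI[symmetric]) auto
  qed
  have "x \<bullet> a \<in> ?I \<and> a \<bullet> x \<in> ?I" if x: "x \<in> ?I" for x a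
  proof -
    let ?X = "{i. component x i \<noteq> 0}" and ?S = "{i. component a i \<noteq> 0}"
    have xa: "component x g \<bullet> component a h \<in> ?I" "component a h \<bullet> component x g \<in> ?I"
      if "g \<in> ?X" "h \<in> ?S" for g h
    proof -
      have gh: "g \<in> carrier G" "h \<in> carrier G" using that by (auto dest: component_nonzero_carrier)
      moreover have "component x g \<in> B g" using x gh by blast
      ultimately show "component x g \<bullet> component a h \<in> ?I" "component a h \<bullet> component x g \<in> ?I"
        using component_mem[of h a]
        by (intro hom[of "g \<otimes> h"] hom[of "h \<otimes> g"] left right; simp)+
    qed
    have "x \<bullet> a = (\<Sum>i\<in>?X. component x i) \<bullet> (\<Sum>j\<in>?S. component a j)"
      by (simp add: sum_component)
    also have "\<dots> = (\<Sum>i\<in>?X. \<Sum>j\<in>?S. component x i \<bullet> component a j)"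
      by (simp only: mul_sum_left) (simp only: mul_sum_right)
    also have "\<dots> \<in> ?I" using xa(1) by (intro subspace_sum[OF I])
    finally have 1: "x \<bullet> a \<in> ?I" .
    have "a \<bullet> x = (\<Sum>j\<in>?S. component a j) \<bullet> (\<Sum>i\<in>?X. component x i)"
      by (simp add: sum_component)
    also have "\<dots> = (\<Sum>j\<in>?S. \<Sum>i\<in>?X. component a j \<bullet> component x i)"
      by (simp only: mul_sum_left) (simp only: mul_sum_right)
    also have "\<dots> \<in> ?I" using xa(2) by (intro subspace_sum[OF I])
    finally show ?thesis using 1 by blast
  qed
  then show ?thesis
    unfolding graded_ideal_def internal_direct_sum_def
    using I dec subspace_A by (auto intro: subspace_inter)
qed

end

section \<open>Normalised cocycles and the associativity that remains\<close>

context graded_quasialgebra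
begin

lemma cocycle_nonzero:
  "\<lbrakk>g \<in> carrier G; h \<in> carrier G; k \<in> carrier G\<rbrakk> \<Longrightarrow> \<phi> g h k \<noteq> 0"
  using cocycle unfolding cocycle_def by blast

lemma cocycle_mid_one: "\<lbrakk>g \<in> carrier G; h \<in> carrier G\<rbrakk> \<Longrightarrow> \<phi> g \<one> h = 1"
  using cocycle unfolding cocycle_def by blast

lemma cocycle_identity:
  "\<lbrakk>g \<in> carrier G; h \<in> carrier G; k \<in> carrier G; l \<in> carrier G\<rbrakk> \<Longrightarrow>
    \<phi> h k l * \<phi> g (h \<otimes> k) l * \<phi> g h k = \<phi> g h (k \<otimes> l) * \<phi> (g \<otimes> h) k l"
  using cocycle unfolding cocycle_def by blast

text \<open>At (\<open>\<one>\<close>, \<open>\<one>\<close>, h, k) the cocycle identity says that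
  this value equals its own square; being nonzero, it is 1.\<close>

lemma cocycle_left_one:
  assumes "h \<in> carrier G" "k \<in> carrier G"
  shows "\<phi> \<one> h k = 1"
  using cocycle_identity[of \<one> \<one> h k] cocycle_nonzero[of \<one> h k] assms
  by (simp add: cocycle_mid_one)

text \<open>The same cancellation, now at (g, h, \<open>\<one>\<close>,
  \<open>\<one>\<close>).\<close>

lemma cocycle_right_one:
  assumes "g \<in> carrier G" "h \<in> carrier G"
  shows "\<phi> g h \<one> = 1"
  using cocycle_identity[of g h \<one> \<one>] cocycle_nonzero[of g h \<one>] assms
  by (simp add: cocycle_mid_one)

text \<open>This law and the next two show that a product of three homogeneous factors associates
  strictly once one factor has degree \<open>\<one>\<close>.\<close>

lemma assoc_left_one:
  "\<lbrakk>h \<in> carrier G; k \<in> carrier G; x \<in> A \<one>; y \<in> A h; z \<in> A k\<rbrakk> \<Longrightarrow> (x \<bullet> y) \<bullet> z = x \<bullet> (y \<bullet> z)"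
  using quasiassoc[of \<one> h k x y z] by (simp add: cocycle_left_one)

lemma assoc_mid_one:
  "\<lbrakk>g \<in> carrier G; k \<in> carrier G; x \<in> A g; y \<in> A \<one>; z \<in> A k\<rbrakk> \<Longrightarrow> (x \<bullet> y) \<bullet> z = x \<bullet> (y \<bullet> z)"
  using quasiassoc[of g \<one> k x y z] by (simp add: cocycle_mid_one)

lemma assoc_right_one:
  "\<lbrakk>g \<in> carrier G; h \<in> carrier G; x \<in> A g; y \<in> A h; z \<in> A \<one>\<rbrakk> \<Longrightarrow> (x \<bullet> y) \<bullet> z = x \<bullet> (y \<bullet> z)"
  using quasiassoc[of g h \<one> x y z] by (simp add: cocycle_right_one)

lemma quasiassoc':
  assumes "g \<in> carrier G" "h \<in> carrier G" "k \<in> carrier G" "x \<in> A g" "y \<in> A h" "z \<in> A k"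
  shows "x \<bullet> (y \<bullet> z) = inverse (\<phi> g h k) *s ((x \<bullet> y) \<bullet> z)"
  using quasiassoc[OF assms] cocycle_nonzero[OF assms(1-3)] by simp

section \<open>The Jacobson radical of \<open>A \<one>\<close> and products of opposite
  degrees\<close>

lemma associative_subalgebra_A_one: "associative_subalgebra (A \<one>)"
proof -
  have "x \<bullet> y \<in> A \<one>" if "x \<in> A \<one>" "y \<in> A \<one>" for x y
    using graded_mul[of \<one> \<one> x y] that by simp
  then show ?thesis
    unfolding associative_subalgebra_def
    using subspace_A unity_homogeneous by (auto intro: assoc_mid_one)
qed

lemmas subspace_jacobson =
  jacobson_radical_left_ideal_in[OF associative_subalgebra_A_one, unfolded left_ideal_in_def,
    THEN conjunct1]

lemma jacobson_radical_left_mul: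
  "\<lbrakk>r \<in> A \<one>; x \<in> jacobson_radical (A \<one>)\<rbrakk> \<Longrightarrow> r \<bullet> x \<in> jacobson_radical (A \<one>)"
  using jacobson_radical_left_ideal_in[OF associative_subalgebra_A_one]
  unfolding left_ideal_in_def by blast

lemma jacobson_radical_subset: "jacobson_radical (A \<one>) \<subseteq> A \<one>"
  unfolding jacobson_radical_def by blast

text \<open>The scalar \<open>\<mu>\<close> compensates for the reassociation of \<open>a (y a)\<close> to \<open>(a y) a\<close>.\<close>

lemma left_inverse_transfer:
  assumes h: "h \<in> carrier G" and y: "y \<in> A (inv h)" and a: "a \<in> A h"
    and c: "c \<in> A \<one>" "c \<bullet> (unity - \<mu> *s (a \<bullet> y)) = unity"
    and \<mu>: "\<mu> = inverse (\<phi> h (inv h) h)"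
  shows "(unity + (y \<bullet> c) \<bullet> a) \<bullet> (unity - y \<bullet> a) = unity"
proof -
  have ih: "inv h \<in> carrier G" using h by simp
  have ay: "a \<bullet> y \<in> A \<one>" using graded_mul[OF h ih a y] h by simp
  have ya: "y \<bullet> a \<in> A \<one>" using graded_mul[OF ih h y a] h by simp
  have yc: "y \<bullet> c \<in> A (inv h)" using graded_mul[OF ih _ y c(1)] ih by simp
  have ca: "c \<bullet> a \<in> A h" using graded_mul[OF _ h c(1) a] h by simp
  have aya: "(a \<bullet> y) \<bullet> a \<in> A h" using graded_mul[OF _ h ay a] h by simp
  have yca: "(y \<bullet> c) \<bullet> a = y \<bullet> (c \<bullet> a)" by (rule assoc_mid_one[OF ih h y c(1) a])
  \<comment> \<open>The equation for the left inverse, solved for the term that the reassociation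
    below produces.\<close>
  have c': "\<mu> *s (c \<bullet> (a \<bullet> y)) = c - unity"
    using c(2) by (simp add: mul_diff_right mul_unity mul_scale_right algebra_simps)
  have "((y \<bullet> c) \<bullet> a) \<bullet> (y \<bullet> a) = (y \<bullet> c) \<bullet> (a \<bullet> (y \<bullet> a))"
    by (rule assoc_right_one[OF ih h yc a ya])
  \<comment> \<open>The only reassociation in this computation without a factor of degree
    \<open>\<one>\<close>, hence the only one that brings in a scalar.\<close>
  also have "a \<bullet> (y \<bullet> a) = \<mu> *s ((a \<bullet> y) \<bullet> a)"
    unfolding \<mu> by (rule quasiassoc'[OF h ih h a y a])
  also have "(y \<bullet> c) \<bullet> (\<mu> *s ((a \<bullet> y) \<bullet> a)) = \<mu> *s (y \<bullet> (c \<bullet> ((a \<bullet> y) \<bullet> a)))"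
    using assoc_mid_one[OF ih h y c(1) aya] by (simp add: mul_scale_right)
  also have "\<dots> = y \<bullet> ((\<mu> *s (c \<bullet> (a \<bullet> y))) \<bullet> a)"
    using assoc_left_one[OF _ h c(1) ay a] by (simp add: mul_scale_right mul_scale_left)
  also have "\<dots> = y \<bullet> (c \<bullet> a) - y \<bullet> a"
    unfolding c' by (simp add: mul_diff_left mul_diff_right unity_mul)
  finally show ?thesis
    by (simp add: mul_add_left mul_diff_right unity_mul mul_unity yca)
qed

text \<open>Left quasi-regularity of y a requires a left inverse of 1 - r (y a) = 1 - (r y) a for
  every \<open>r\<close> in \<open>A \<one>\<close>. It is transferred from 1 - \<open>\<mu>\<close>
  a (r y), where a (r y) = (a r) y. As a r varies with \<open>r\<close>, the assumption ranges over
  all of \<open>A h\<close> and not just over \<open>a\<close>.\<close>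

lemma jacobson_radical_commute:
  assumes h: "h \<in> carrier G" and y: "y \<in> A (inv h)"
    and J: "\<And>b. b \<in> A h \<Longrightarrow> b \<bullet> y \<in> jacobson_radical (A \<one>)" and a: "a \<in> A h"
  shows "y \<bullet> a \<in> jacobson_radical (A \<one>)"
  unfolding jacobson_radical_iff_left_quasiregular[OF associative_subalgebra_A_one]
proof (intro conjI ballI)
  have ih: "inv h \<in> carrier G" using h by simp
  have ya: "x \<bullet> a \<in> A \<one>" if "x \<in> A (inv h)" for x using graded_mul[OF ih h that a] h by simp
  show "y \<bullet> a \<in> A \<one>" using ya[OF y] .
  fix r assume r: "r \<in> A \<one>"
  let ?\<mu> = "inverse (\<phi> h (inv h) h)"
  have ry: "r \<bullet> y \<in> A (inv h)" using graded_mul[OF _ ih r y] h by simp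
  have "a \<bullet> r \<in> A h" using graded_mul[OF h _ a r] h by simp
  then have "a \<bullet> (r \<bullet> y) \<in> jacobson_radical (A \<one>)"
    using J assoc_mid_one[OF h ih a r y] by metis
  \<comment> \<open>The scalar is absorbed into the multiplier of quasi-regularity, which must be an
    element of \<open>A \<one>\<close>.\<close>
  moreover have "?\<mu> *s unity \<in> A \<one>"
    using subspace_A unity_homogeneous subspace_scale by blast
  ultimately obtain c where c: "c \<in> A \<one>"
    "c \<bullet> (unity - (?\<mu> *s unity) \<bullet> (a \<bullet> (r \<bullet> y))) = unity"
    using jacobson_radical_iff_left_quasiregular[OF associative_subalgebra_A_one] by blast
  then have "c \<bullet> (unity - ?\<mu> *s (a \<bullet> (r \<bullet> y))) = unity"
    by (simp add: mul_scale_left unity_mul)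
  from left_inverse_transfer[OF h ry a c(1) this refl]
  have "(unity + ((r \<bullet> y) \<bullet> c) \<bullet> a) \<bullet> (unity - r \<bullet> (y \<bullet> a)) = unity"
    using assoc_left_one[OF ih h r y a] by simp
  moreover have "(r \<bullet> y) \<bullet> c \<in> A (inv h)" using graded_mul[OF ih _ ry c(1)] ih by simp
  then have "unity + ((r \<bullet> y) \<bullet> c) \<bullet> a \<in> A \<one>"
    using ya subspace_A unity_homogeneous subspace_add by blast
  ultimately show "\<exists>c\<in>A \<one>. c \<bullet> (unity - r \<bullet> (y \<bullet> a)) = unity" by blast
qed

section \<open>The graded ideal whose component of degree \<open>\<one>\<close> is the
  radical\<close>

definition radical_component :: "'g \<Rightarrow> 'a set" where
  "radical_component g = {x \<in> A g. \<forall>v\<in>A (inv g). v \<bullet> x \<in> jacobson_radical (A \<one>)}"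

lemma subspace_radical_component:
  assumes "g \<in> carrier G"
  shows "subspace (radical_component g)"
  unfolding radical_component_def
  by (rule subspaceI) (simp_all add: mul_add_right mul_scale_right
      subspace_0[OF subspace_A[OF assms]] subspace_0[OF subspace_jacobson]
      subspace_add[OF subspace_A[OF assms]] subspace_add[OF subspace_jacobson]
      subspace_scale[OF subspace_A[OF assms]] subspace_scale[OF subspace_jacobson])

text \<open>One inclusion tests with v = 1; the other holds because the radical is a left ideal of
  \<open>A \<one>\<close>.\<close>

lemma radical_component_one: "radical_component \<one> = jacobson_radical (A \<one>)"
proof -
  have "x \<in> jacobson_radical (A \<one>)" if "x \<in> radical_component \<one>" for x
  proof -
    have "unity \<bullet> x \<in> jacobson_radical (A \<one>)"
      using that unity_homogeneous unfolding radical_component_def by simp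
    then show ?thesis by (simp add: unity_mul)
  qed
  moreover have "x \<in> radical_component \<one>" if "x \<in> jacobson_radical (A \<one>)" for x
    using that jacobson_radical_subset jacobson_radical_left_mul[OF _ that]
    unfolding radical_component_def by (simp add: subset_iff)
  ultimately show ?thesis by blast
qed

text \<open>On the left, v (a x) is a scalar multiple of (v a) x, and v a has degree
  \<open>inv g\<close>. On the right, \<open>x\<close> sits between \<open>v\<close> and
  \<open>a\<close>, so v x is first shown to satisfy the hypothesis of
  \<open>jacobson_radical_commute\<close>.\<close>

lemma radical_component_mul:
  assumes g: "g \<in> carrier G" and h: "h \<in> carrier G"
    and x: "x \<in> radical_component g" and a: "a \<in> A h"
  shows "a \<bullet> x \<in> radical_component (h \<otimes> g)" and "x \<bullet> a \<in> radical_component (g \<otimes> h)"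
proof -
  let ?J = "jacobson_radical (A \<one>)"
  have ig: "inv g \<in> carrier G" and ih: "inv h \<in> carrier G" using g h by auto
  have xA: "x \<in> A g" and xJ: "\<And>v. v \<in> A (inv g) \<Longrightarrow> v \<bullet> x \<in> ?J"
    using x unfolding radical_component_def by auto
  have "v \<bullet> (a \<bullet> x) \<in> ?J" if v: "v \<in> A (inv (h \<otimes> g))" for v
  proof -
    have "v \<bullet> a \<in> A (inv (h \<otimes> g) \<otimes> h)" using graded_mul v a g h by simp
    also have "inv (h \<otimes> g) \<otimes> h = inv g" using g h by (simp add: G.inv_mult_group G.m_assoc)
    finally have "(v \<bullet> a) \<bullet> x \<in> ?J" using xJ by blast
    then show ?thesis
      using quasiassoc'[OF _ h g v a xA] g h subspace_scale[OF subspace_jacobson] by simp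
  qed
  then show "a \<bullet> x \<in> radical_component (h \<otimes> g)"
    unfolding radical_component_def using graded_mul[OF h g a xA] by blast
  have "v \<bullet> (x \<bullet> a) \<in> ?J" if v: "v \<in> A (inv (g \<otimes> h))" for v
  proof -
    have igh: "inv (g \<otimes> h) \<in> carrier G" using g h by simp
    have vx: "v \<bullet> x \<in> A (inv h)"
      using graded_mul[OF igh g v xA] g h by (simp add: G.inv_mult_group G.m_assoc)
    have "b \<bullet> (v \<bullet> x) \<in> ?J" if b: "b \<in> A h" for b
    proof -
      have "b \<bullet> v \<in> A (h \<otimes> inv (g \<otimes> h))" using graded_mul[OF h igh b v] .
      also have "h \<otimes> inv (g \<otimes> h) = inv g"
        using g h by (simp add: G.inv_mult_group flip: G.m_assoc)
      finally have "(b \<bullet> v) \<bullet> x \<in> ?J" using xJ by blast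
      then show ?thesis
        using quasiassoc'[OF h igh g b v xA] subspace_scale[OF subspace_jacobson] by simp
    qed
    \<comment> \<open>Left multiplication of v x by \<open>A h\<close> lands in the radical, so
      right multiplication by \<open>a\<close> does too.\<close>
    then have "(v \<bullet> x) \<bullet> a \<in> ?J" using jacobson_radical_commute[OF h vx _ a] by blast
    then show ?thesis
      using quasiassoc'[OF igh g h v xA a] subspace_scale[OF subspace_jacobson] by simp
  qed
  then show "x \<bullet> a \<in> radical_component (g \<otimes> h)"
    unfolding radical_component_def using graded_mul[OF g h xA a] by blast
qed

theorem graded_simple_imp_semisimple_A_one:
  assumes "graded_simple"
  shows "semisimple_associative_subalgebra (A \<one>)"
proof -
  let ?I = "{x. \<forall>g\<in>carrier G. component x g \<in> radical_component g}"
  let ?J = "jacobson_radical (A \<one>)"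
  have "graded_ideal ?I"
  proof (rule graded_ideal_of_components)
    show "subspace (radical_component g) \<and> radical_component g \<subseteq> A g" if "g \<in> carrier G" for g
      using subspace_radical_component[OF that] unfolding radical_component_def by blast
  qed (rule radical_component_mul; assumption)+
  then have "?I = {0} \<or> ?I = UNIV" using assms unfolding graded_simple_def by blast
  \<comment> \<open>This excludes the whole algebra: the degree \<open>\<one>\<close> component of
    \<open>unity\<close> is \<open>unity\<close>, which is not in the radical.\<close>
  moreover have "unity \<notin> ?I"
  proof
    assume "unity \<in> ?I"
    then have "component unity \<one> \<in> radical_component \<one>" by simp
    then show False
      using unity_notin_jacobson_radical[OF associative_subalgebra_A_one]
      by (simp add: component_homogeneous[OF _ unity_homogeneous] radical_component_one)
  qed
  ultimately have I: "?I = {0}" by blast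
  \<comment> \<open>Elements of the radical are homogeneous of degree \<open>\<one>\<close>, so all
    their other components are 0.\<close>
  have "x \<in> ?I" if x: "x \<in> ?J" for x
  proof -
    have "x \<in> A \<one>" using x jacobson_radical_subset by blast
    then show ?thesis
      using x component_homogeneous[of \<one> x] radical_component_one
        subspace_0[OF subspace_radical_component] by auto
  qed
  then have "?J = {0}" using I subspace_0[OF subspace_jacobson] by blast
  then show ?thesis
    unfolding semisimple_associative_subalgebra_def using associative_subalgebra_A_one by blast
qed

end

theorem theorem7p11:
  fixes scale :: "'k::{alg_closed_field, field_char_0} \<Rightarrow> 'a::ab_group_add \<Rightarrow> 'a"
    and mul :: "'a \<Rightarrow> 'a \<Rightarrow> 'a"
    and unity :: 'a
    and G :: "('g, 'm) monoid_scheme"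
    and A :: "'g \<Rightarrow> 'a set"
    and \<phi> :: "'g \<Rightarrow> 'g \<Rightarrow> 'g \<Rightarrow> 'k"
  assumes "graded_quasialgebra scale mul unity G A \<phi>"
    and "graded_algebra.quasicrossed_product mul unity G A"
    and "graded_algebra.graded_simple scale mul G A"
  shows "nonassoc_algebra.semisimple_associative_subalgebra scale mul unity (A \<one>\<^bsub>G\<^esub>)"
  using graded_quasialgebra.graded_simple_imp_semisimple_A_one[OF assms(1,3)] .

end
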